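(* Let $\Gamma$ be a closed subgroup of a finite direct product of affine automorphism groups of homogeneous trees, $P=\prod_{i=1}^k\operatorname{Aff}\mathcal{T}_i$. Suppose that the action of $\Gamma$ on the product of trees $\prod_{i=1}^k\mathcal{T}_i$ is transitive. Then $\Gamma$ is generated by the compact neighbourhood of the identity \[ J=\{\alpha\in\Gamma : |\alpha|_P\le1\}. \]
   Context: Each $\mathcal{T}_i$ is a homogeneous tree (every vertex has the same finite number $d_i\ge3$ of neighbours) with a distinguished vertex $o_i$ and a distinguished end $\omega_i$ (an end is an equivalence class of geodesic rays, equivalent when their intersection is infinite). $\operatorname{Aff}\mathcal{T}_i$ is the group of automorphisms of $\mathcal{T}_i$ fixing $\omega_i$, with the topology of pointwise convergence on vertices; $P$ has the product topology. $P$ acts coordinatewise on $\prod_i\mathcal{T}_i$, the Cartesian product of the vertex sets; transitivity refers to this action. For $\alpha=(\alpha_1,\dots,\alpha_k)\in P$, $|\alpha|_P=\sum_{i=1}^k d(o_i,\alpha_io_i)$, with $d$ the graph distance. *)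

theory Defs
  imports
    "Graph_Theory.Graph_Theory"
    "HOL-Algebra.Bij"
    "HOL-Algebra.Generated_Groups"
    "HOL-Algebra.Group_Action"
    "HOL-Algebra.Product_Groups"
    "HOL-Analysis.Abstract_Topology"
    "HOL-Analysis.Function_Topology"
begin

text \<open>
  Undirected simple graphs, possibly infinite, are loop-free symmetric digraphs whose arcs are
  pairs of vertices. In this representation \<open>cycle\<close> also holds of the back-and-forth walk
  along a single edge (two arcs), so an undirected circuit is a cycle with at least three arcs.
  For the same reason the notion \<open>tree\<close> of \<open>Graph_Theory\<close>, which forbids all directed cycles,
  cannot be used: a symmetric digraph with an edge never satisfies it.
\<close>

definition undirected_tree :: "'v pair_pre_digraph \<Rightarrow> bool" where
  "undirected_tree T \<longleftrightarrow> pair_bidirected_digraph T \<and> connected (with_proj T) \<and>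
     (\<nexists>p. pre_digraph.cycle (with_proj T) p \<and> 3 \<le> length p)"

definition homogeneous_tree :: "nat \<Rightarrow> 'v pair_pre_digraph \<Rightarrow> bool" where
  "homogeneous_tree d T \<longleftrightarrow> undirected_tree T \<and> (\<forall>v\<in>pverts T. out_degree (with_proj T) v = d)"

text \<open>
  The graph distance is the shortest-path distance for unit arc weights; it is finite
  between any two vertices of a connected graph.
\<close>

definition graph_dist :: "'v pair_pre_digraph \<Rightarrow> 'v \<Rightarrow> 'v \<Rightarrow> real" where
  "graph_dist T u v = real_of_ereal (wf_digraph.\<mu> (with_proj T) (\<lambda>_. 1) u v)"

definition geodesic_ray :: "'v pair_pre_digraph \<Rightarrow> (nat \<Rightarrow> 'v) \<Rightarrow> bool" where
  "geodesic_ray T x \<longleftrightarrow> range x \<subseteq> pverts T \<and>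
     (\<forall>m n. graph_dist T (x m) (x n) = \<bar>real m - real n\<bar>)"

definition ray_equiv :: "'v pair_pre_digraph \<Rightarrow> ((nat \<Rightarrow> 'v) \<times> (nat \<Rightarrow> 'v)) set" where
  "ray_equiv T =
     {(x, y). geodesic_ray T x \<and> geodesic_ray T y \<and> infinite (range x \<inter> range y)}"

definition tree_ends :: "'v pair_pre_digraph \<Rightarrow> (nat \<Rightarrow> 'v) set set" where
  "tree_ends T = {x. geodesic_ray T x} // ray_equiv T"

text \<open>
  Automorphisms are bijections of the vertex set that are \<open>undefined\<close> outside it
  (as in \<open>BijGroup\<close>), so that equal automorphisms are equal as functions.
\<close>

definition tree_auts :: "'v pair_pre_digraph \<Rightarrow> ('v \<Rightarrow> 'v) set" where
  "tree_auts T = {g \<in> Bij (pverts T).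
     \<forall>u\<in>pverts T. \<forall>v\<in>pverts T. (g u, g v) \<in> parcs T \<longleftrightarrow> (u, v) \<in> parcs T}"

definition Aff :: "'v pair_pre_digraph \<Rightarrow> (nat \<Rightarrow> 'v) set \<Rightarrow> ('v \<Rightarrow> 'v) monoid" where
  "Aff T \<omega> = BijGroup (pverts T)
     \<lparr>carrier := {g \<in> tree_auts T. (\<lambda>x. g \<circ> x) ` \<omega> = \<omega>}\<rparr>"

definition Aff_topology :: "'v pair_pre_digraph \<Rightarrow> (nat \<Rightarrow> 'v) set \<Rightarrow> ('v \<Rightarrow> 'v) topology" where
  "Aff_topology T \<omega> =
     subtopology (product_topology (\<lambda>_. discrete_topology (pverts T)) (pverts T))
       (carrier (Aff T \<omega>))"

definition Aff_prod ::
    "nat \<Rightarrow> (nat \<Rightarrow> 'v pair_pre_digraph) \<Rightarrow> (nat \<Rightarrow> (nat \<Rightarrow> 'v) set) \<Rightarrow> (nat \<Rightarrow> 'v \<Rightarrow> 'v) monoid"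
  where "Aff_prod k T \<omega> = product_group {1..k} (\<lambda>i. Aff (T i) (\<omega> i))"

definition Aff_prod_topology ::
    "nat \<Rightarrow> (nat \<Rightarrow> 'v pair_pre_digraph) \<Rightarrow> (nat \<Rightarrow> (nat \<Rightarrow> 'v) set) \<Rightarrow> (nat \<Rightarrow> 'v \<Rightarrow> 'v) topology"
  where "Aff_prod_topology k T \<omega> = product_topology (\<lambda>i. Aff_topology (T i) (\<omega> i)) {1..k}"

definition tree_prod :: "nat \<Rightarrow> (nat \<Rightarrow> 'v pair_pre_digraph) \<Rightarrow> (nat \<Rightarrow> 'v) set" where
  "tree_prod k T = (\<Pi>\<^sub>E i\<in>{1..k}. pverts (T i))"

definition coord_action ::
    "nat \<Rightarrow> (nat \<Rightarrow> 'v pair_pre_digraph) \<Rightarrow> (nat \<Rightarrow> 'v \<Rightarrow> 'v) \<Rightarrow> (nat \<Rightarrow> 'v) \<Rightarrow> nat \<Rightarrow> 'v" where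
  "coord_action k T \<alpha> = (\<lambda>x\<in>tree_prod k T. \<lambda>i\<in>{1..k}. \<alpha> i (x i))"

definition prod_length ::
    "nat \<Rightarrow> (nat \<Rightarrow> 'v pair_pre_digraph) \<Rightarrow> (nat \<Rightarrow> 'v) \<Rightarrow> (nat \<Rightarrow> 'v \<Rightarrow> 'v) \<Rightarrow> real" where
  "prod_length k T base \<alpha> = (\<Sum>i=1..k. graph_dist (T i) (base i) (\<alpha> i (base i)))"

end

theory Submission
  imports Defs
begin

text \<open>
  The length is integer-valued and continuous, so the elements of \<open>\<Gamma>\<close> of length less than \<open>1\<close> form an
  open set that contains the identity and lies in \<open>J\<close>. Two things need an argument.

  Generation. Write \<open>o\<close> for the base point of the product. For \<open>\<alpha> \<in> \<Gamma>\<close>, walk from \<open>o\<close> to \<open>\<alpha> o\<close> along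
  edges, moving one coordinate at a time. By transitivity every vertex on this walk is \<open>\<beta> o\<close> for some
  \<open>\<beta> \<in> \<Gamma>\<close>. If \<open>\<beta> o\<close> and \<open>\<beta>' o\<close> are consecutive then \<open>\<beta>\<inverse>\<beta>'\<close> has length \<open>1\<close>, because \<open>\<beta>\<close> preserves
  distances. So \<open>\<alpha>\<close> is a product of elements of \<open>J\<close>
  (\<open>transitive_subgroup_generated_by_short_elements\<close>).

  Compactness. An automorphism that moves \<open>o\<close> by at most \<open>r\<close> maps every vertex \<open>v\<close> into the ball of
  radius \<open>r + d(o, v)\<close>, which is finite. By Tychonoff's theorem it is enough that a pointwise limit \<open>g\<close>
  of such automorphisms fixing the end \<open>\<omega>\<close> is again one of them (\<open>Aff_pointwise_limit\<close>). The inverse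
  images of a vertex stay in a finite set, so \<open>g\<close> is onto. That \<open>g\<close> fixes \<open>\<omega>\<close> rests on the geometry of
  trees: a ray of \<open>\<omega>\<close> is determined by its starting point (\<open>ray_determined_by_start\<close>), so an element
  fixing \<open>\<omega>\<close> acts on a whole ray as soon as its value at the start is known. Hence \<open>g\<close> agrees along
  each ray of \<open>\<omega>\<close> with a single approximating automorphism. Starting points determine rays because
  geodesics in a graph without circuits are unique (\<open>geodesic_seg_unique\<close>).
\<close>

section \<open>Distance in connected graphs as a number of steps\<close>

text \<open>
  A natural-number form of the graph distance. The relational power counts walks by their number of
  arcs, which makes the triangle inequality and the invariance under automorphisms inductive facts
  about relations. Between vertices that no walk joins the value is unspecified.
\<close>
definition hop_dist :: "'v pair_pre_digraph \<Rightarrow> 'v \<Rightarrow> 'v \<Rightarrow> nat" where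
  "hop_dist T u v = (LEAST n. (u, v) \<in> parcs T ^^ n)"

lemma Bij_apply: "g \<in> Bij S \<Longrightarrow> v \<in> S \<Longrightarrow> g v \<in> S"
  using Bij_imp_funcset by blast

locale connected_graph = pair_bidirected_digraph T for T :: "'v pair_pre_digraph" +
  assumes connected: "connected (with_proj T)"
begin

lemma relpow_iff_awalk:
  assumes "u \<in> pverts T"
  shows "(u, v) \<in> parcs T ^^ n \<longleftrightarrow> (\<exists>p. awalk u p v \<and> length p = n)"
  using assms
proof (induction n arbitrary: u)
  case 0
  then show ?case by (auto simp: awalk_Nil_iff)
next
  case (Suc n)
  show ?case
  proof
    assume "(u, v) \<in> parcs T ^^ Suc n"
    then obtain w where w: "(u, w) \<in> parcs T" "(w, v) \<in> parcs T ^^ n"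
      by (meson relpow_Suc_D2)
    then obtain p where "awalk w p v" "length p = n"
      using Suc.IH in_arcsD2 by blast
    then show "\<exists>p. awalk u p v \<and> length p = Suc n"
      using w by (intro exI[of _ "(u, w) # p"]) (auto simp: awalk_Cons_iff)
  next
    assume "\<exists>p. awalk u p v \<and> length p = Suc n"
    then obtain e p where "awalk u (e # p) v" "length p = n"
      by (auto simp: length_Suc_conv)
    then have e: "e \<in> parcs T" "u = fst e" "awalk (snd e) p v" "length p = n"
      by (auto simp: awalk_Cons_iff)
    then have "(u, snd e) \<in> parcs T" "(snd e, v) \<in> parcs T ^^ n"
      using Suc.IH[of "snd e"] arc_snd_in_verts by auto
    then show "(u, v) \<in> parcs T ^^ Suc n"
      by (rule relpow_Suc_I2)
  qed
qed

lemma relpow_hop_dist: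
  assumes "u \<in> pverts T" "v \<in> pverts T"
  shows "(u, v) \<in> parcs T ^^ hop_dist T u v"
proof -
  have "u \<rightarrow>\<^sup>*\<^bsub>mk_symmetric (with_proj T)\<^esub> v"
    using connected assms unfolding connected_def strongly_connected_def by simp
  then have "u \<rightarrow>\<^sup>*\<^bsub>with_proj T\<^esub> v"
    using reachable_mk_symmetric_eq pair_sym_arcs by blast
  then obtain p where "awalk u p v"
    using reachable_awalk by blast
  then have "(u, v) \<in> parcs T ^^ length p"
    using relpow_iff_awalk[OF assms(1)] by blast
  then show ?thesis
    unfolding hop_dist_def by (rule LeastI)
qed

lemma hop_dist_le: "(u, v) \<in> parcs T ^^ n \<Longrightarrow> hop_dist T u v \<le> n"
  unfolding hop_dist_def by (rule Least_le)

lemma graph_dist_eq_hop_dist: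
  assumes "u \<in> pverts T" "v \<in> pverts T"
  shows "graph_dist T u v = real (hop_dist T u v)"
proof -
  have cost: "awalk_cost (\<lambda>_. 1) p = real (length p)" for p
    by (induction p) auto
  obtain p where p: "awalk u p v" "length p = hop_dist T u v"
    using relpow_hop_dist[OF assms] relpow_iff_awalk[OF assms(1)] by blast
  have "\<mu> (\<lambda>_. 1) u v = ereal (real (hop_dist T u v))"
    unfolding \<mu>_def cost
  proof (rule antisym)
    show "(INF p\<in>{p. awalk u p v}. ereal (real (length p))) \<le> ereal (real (hop_dist T u v))"
      using p by (intro INF_lower2[of p]) auto
    show "ereal (real (hop_dist T u v)) \<le> (INF p\<in>{p. awalk u p v}. ereal (real (length p)))"
      by (intro INF_greatest) (use relpow_iff_awalk[OF assms(1)] in \<open>auto intro!: hop_dist_le\<close>)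
  qed
  then show ?thesis
    unfolding graph_dist_def by simp
qed

lemma sym_relpow: "(u, v) \<in> parcs T ^^ n \<Longrightarrow> (v, u) \<in> parcs T ^^ n"
  by (induction n arbitrary: v) (auto simp del: relpow.simps(2) elim!: relpow_Suc_E
      intro: relpow_Suc_I2 arcs_symmetric)

lemma hop_dist_refl [simp]: "hop_dist T u u = 0"
  using hop_dist_le[of u u 0] by simp

lemma hop_dist_sym: "hop_dist T u v = hop_dist T v u"
  unfolding hop_dist_def by (metis sym_relpow)

lemma hop_dist_triangle:
  assumes "u \<in> pverts T" "v \<in> pverts T" "w \<in> pverts T"
  shows "hop_dist T u w \<le> hop_dist T u v + hop_dist T v w"
  using relpow_hop_dist[OF assms(1,2)] relpow_hop_dist[OF assms(2,3)]
  by (intro hop_dist_le) (auto simp: relpow_add)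

lemma hop_dist_eq_0_iff:
  assumes "u \<in> pverts T" "v \<in> pverts T"
  shows "hop_dist T u v = 0 \<longleftrightarrow> u = v"
  using relpow_hop_dist[OF assms] by auto

lemma hop_dist_eq_1_iff:
  assumes "u \<in> pverts T" "v \<in> pverts T"
  shows "hop_dist T u v = 1 \<longleftrightarrow> (u, v) \<in> parcs T"
proof
  assume "hop_dist T u v = 1"
  then show "(u, v) \<in> parcs T"
    using relpow_hop_dist[OF assms] by auto
next
  assume arc: "(u, v) \<in> parcs T"
  then have "hop_dist T u v \<le> 1"
    by (intro hop_dist_le) simp
  moreover have "hop_dist T u v \<noteq> 0"
    using arc pair_no_loops hop_dist_eq_0_iff[OF assms] by fastforce
  ultimately show "hop_dist T u v = 1" by simp
qed

text \<open>
  The last step of a shortest walk.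
\<close>
lemma hop_dist_Suc_predecessor:
  assumes "u \<in> pverts T" "v \<in> pverts T" "hop_dist T u v = Suc n"
  obtains w where "w \<in> pverts T" "hop_dist T u w = n" "(w, v) \<in> parcs T"
proof -
  obtain w where w: "(u, w) \<in> parcs T ^^ n" "(w, v) \<in> parcs T"
    using relpow_hop_dist[OF assms(1,2)] assms(3) by auto
  have wV: "w \<in> pverts T"
    using w(2) in_arcsD1 by blast
  have "hop_dist T u v \<le> hop_dist T u w + hop_dist T w v"
    using hop_dist_triangle assms wV by blast
  moreover have "hop_dist T w v = 1"
    using hop_dist_eq_1_iff w(2) wV assms(2) by blast
  ultimately have "hop_dist T u w = n"
    using hop_dist_le[OF w(1)] assms(3) by simp
  then show thesis using that wV w by blast
qed

text \<open>
  The ball of radius \<open>n + 1\<close> is covered by the ball of radius \<open>n\<close> and the finitely many out-neighbours of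
  its vertices.
\<close>
lemma finite_ball:
  assumes fin: "\<And>v. v \<in> pverts T \<Longrightarrow> finite (out_arcs (with_proj T) v)"
    and u: "u \<in> pverts T"
  shows "finite {v \<in> pverts T. hop_dist T u v \<le> n}"
proof (induction n)
  case 0
  have "{v \<in> pverts T. hop_dist T u v \<le> 0} \<subseteq> {u}"
    using hop_dist_eq_0_iff u by auto
  then show ?case by (rule finite_subset) simp
next
  case (Suc n)
  let ?B = "\<lambda>n. {v \<in> pverts T. hop_dist T u v \<le> n}"
  have "?B (Suc n) \<subseteq> ?B n \<union> (\<Union>w\<in>?B n. snd ` out_arcs (with_proj T) w)"
  proof
    fix v assume v: "v \<in> ?B (Suc n)"
    show "v \<in> ?B n \<union> (\<Union>w\<in>?B n. snd ` out_arcs (with_proj T) w)"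
    proof (cases "hop_dist T u v = Suc n")
      case True
      then obtain w where w: "w \<in> pverts T" "hop_dist T u w = n" "(w, v) \<in> parcs T"
        using hop_dist_Suc_predecessor u v by blast
      then have "(w, v) \<in> out_arcs (with_proj T) w"
        unfolding out_arcs_def by simp
      then have "v \<in> snd ` out_arcs (with_proj T) w"
        by force
      then show ?thesis using w by blast
    qed (use v in auto)
  qed
  then show ?case
    by (rule finite_subset) (use Suc.IH fin in auto)
qed

text \<open>
  An automorphism carries walks to walks of the same number of steps, and by surjectivity every walk
  between images arises in this way.
\<close>
lemma hop_dist_automorphism:
  assumes g: "g \<in> tree_auts T" and u: "u \<in> pverts T" and v: "v \<in> pverts T"
  shows "hop_dist T (g u) (g v) = hop_dist T u v"
proof -
  have bij: "g \<in> Bij (pverts T)"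
    and arcs: "\<And>u v. u \<in> pverts T \<Longrightarrow> v \<in> pverts T \<Longrightarrow>
      (g u, g v) \<in> parcs T \<longleftrightarrow> (u, v) \<in> parcs T"
    using g unfolding tree_auts_def by auto
  have "(g u, g v) \<in> parcs T ^^ n \<longleftrightarrow> (u, v) \<in> parcs T ^^ n" if "v \<in> pverts T" for n
    using that
  proof (induction n arbitrary: v)
    case 0
    then show ?case
      using bij u unfolding Bij_def bij_betw_def by (auto dest: inj_onD)
  next
    case (Suc n)
    show ?case
    proof
      assume "(g u, g v) \<in> parcs T ^^ Suc n"
      then obtain w where w: "(g u, w) \<in> parcs T ^^ n" "(w, g v) \<in> parcs T"
        by auto
      then obtain w' where w': "w' \<in> pverts T" "w = g w'"
        using bij in_arcsD1 unfolding Bij_def bij_betw_def by blast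
      then show "(u, v) \<in> parcs T ^^ Suc n"
        using w Suc arcs by auto
    next
      assume "(u, v) \<in> parcs T ^^ Suc n"
      then obtain w where w: "(u, w) \<in> parcs T ^^ n" "(w, v) \<in> parcs T"
        by auto
      then have "w \<in> pverts T"
        using in_arcsD1 by blast
      then show "(g u, g v) \<in> parcs T ^^ Suc n"
        using w Suc arcs by auto
    qed
  qed
  then show "hop_dist T (g u) (g v) = hop_dist T u v" 
    using v unfolding hop_dist_def by simp
qed

end

section \<open>Geodesics and rays in trees\<close>

locale tree_graph = connected_graph +
  assumes no_circuit: "cycle p \<Longrightarrow> length p < 3"
begin

text \<open>
  The index form in which circuits arise below: a closed sequence of at least three arcs whose vertices
  are distinct until it closes up.
\<close>
lemma no_circuit_sequence:
  assumes "3 \<le> m" and "inj_on c {..<m}" and "c m = c 0"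
    and arcs: "\<And>i. i < m \<Longrightarrow> (c i, c (Suc i)) \<in> parcs T"
  shows False
proof -
  let ?p = "\<lambda>m. map (\<lambda>i. (c i, c (Suc i))) [0..<m]"
  have c0: "c 0 \<in> pverts T"
    using arcs[of 0] assms(1) in_arcsD1 by auto
  have walk: "awalk (c 0) (?p n) (c n)" if "n \<le> m" for n
    using that
  proof (induction n)
    case 0
    then show ?case using c0 by (simp add: awalk_Nil_iff)
  next
    case (Suc n)
    then have "awalk (c n) [(c n, c (Suc n))] (c (Suc n))"
      using arcs[of n] in_arcsD2 by (auto simp: awalk_simps)
    then show ?case
      using Suc awalk_appendI by fastforce
  qed
  have "pawalk_verts (c 0) (?p m) = c 0 # map (\<lambda>i. c (Suc i)) [0..<m]"
    using awalk_verts_conv'[of "c 0" "?p m" "c m"] walk[of m] assms(1)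
    by (auto simp: awalk_def hd_map comp_def)
  moreover have "inj_on (\<lambda>i. c (Suc i)) {0..<m}"
  proof (rule inj_onI)
    fix i j assume ij: "i \<in> {0..<m}" "j \<in> {0..<m}" "c (Suc i) = c (Suc j)"
    \<comment> \<open>Only the last index leaves the range of injectivity, where \<open>c m = c 0\<close>.\<close>
    define r where "r n = (if n = m then 0 else n)" for n
    have "c (r (Suc i)) = c (r (Suc j))"
      using ij(3) assms(3) by (auto simp: r_def)
    moreover have "r (Suc i) < m" "r (Suc j) < m"
      using ij by (auto simp: r_def)
    ultimately have "r (Suc i) = r (Suc j)"
      using assms(2) by (auto dest: inj_onD)
    then show "i = j"
      by (auto simp: r_def split: if_splits)
  qed
  ultimately have "distinct (tl (pawalk_verts (c 0) (?p m)))"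
    by (simp add: distinct_map)
  then have "cycle (?p m)"
    unfolding cycle_def using walk[of m] assms(1,3) by auto
  then show False
    using no_circuit assms(1) by fastforce
qed

definition geodesic_seg :: "(nat \<Rightarrow> 'a) \<Rightarrow> nat \<Rightarrow> bool" where
  "geodesic_seg f n \<longleftrightarrow> f ` {..n} \<subseteq> pverts T \<and>
     (\<forall>i j. i \<le> j \<longrightarrow> j \<le> n \<longrightarrow> hop_dist T (f i) (f j) = j - i)"

lemma geodesic_seg_arc:
  assumes "geodesic_seg f n" "i < n"
  shows "(f i, f (Suc i)) \<in> parcs T"
proof -
  have "hop_dist T (f i) (f (Suc i)) = 1" "f i \<in> pverts T" "f (Suc i) \<in> pverts T"
    using assms unfolding geodesic_seg_def by auto
  then show ?thesis
    using hop_dist_eq_1_iff by blast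
qed

text \<open>
  If two geodesics with the same ends differ, let \<open>a\<close> be the last index before they first separate and
  \<open>e\<close> the next index at which they meet. Following one from \<open>a\<close> to \<open>e\<close> and the other back gives a
  circuit: vertices of different index are at different distances from the common start, and vertices
  of equal index strictly between \<open>a\<close> and \<open>e\<close> differ by the choice of \<open>e\<close>.
\<close>
lemma geodesic_seg_unique:
  assumes f: "geodesic_seg f n" and g: "geodesic_seg g n"
    and ends: "f 0 = g 0" "f n = g n" and "j \<le> n"
  shows "f j = g j"
proof (rule ccontr)
  assume "f j \<noteq> g j"
  define b where "b = (LEAST j. f j \<noteq> g j)"
  have b: "f b \<noteq> g b" "b \<le> j"
    using \<open>f j \<noteq> g j\<close> unfolding b_def by (fact LeastI, fact Least_le)
  have before: "f i = g i" if "i < b" for i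
    using that not_less_Least unfolding b_def by blast
  obtain a where a: "b = Suc a"
    using b(1) ends(1) by (cases b) auto
  have bn: "b < n"
    using b ends(2) assms(5) by (metis le_neq_implies_less le_trans)
  define e where "e = (LEAST l. b < l \<and> f l = g l)"
  have e: "b < e" "f e = g e" "e \<le> n"
    using bn ends(2) LeastI[of "\<lambda>l. b < l \<and> f l = g l" n] Least_le[of "\<lambda>l. b < l \<and> f l = g l" n]
    unfolding e_def by auto
  have differ: "f l \<noteq> g l" if "a < l" "l < e" for l
    using that not_less_Least[of l "\<lambda>l. b < l \<and> f l = g l"] b(1) a unfolding e_def
    by (cases "l = b") auto
  \<comment> \<open>The circuit: along \<open>f\<close> up to index \<open>e\<close>, then backwards along \<open>g\<close> to index \<open>a\<close>.\<close>
  define c where "c i = (if i \<le> e - a then f (a + i) else g (2 * e - a - i))" for i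
  let ?level = "\<lambda>i. if i \<le> e - a then a + i else 2 * e - a - i"
  have level: "hop_dist T (f 0) (c i) = ?level i" if "i < 2 * (e - a)" for i
  proof -
    have "hop_dist T (f 0) (f l) = l" "hop_dist T (f 0) (g l) = l" if "l \<le> n" for l
      using that f g ends(1) unfolding geodesic_seg_def by (metis diff_zero zero_le)+
    then show ?thesis
      using that e unfolding c_def by auto
  qed
  have c_on_g: "c i = g (2 * e - a - i)" if "e - a \<le> i" for i
    using that e a unfolding c_def by (auto dest!: le_antisym)
  have "inj_on c {..<2 * (e - a)}"
  proof (rule linorder_inj_onI')
    fix i j assume ij: "i \<in> {..<2 * (e - a)}" "j \<in> {..<2 * (e - a)}" "i < j"
    show "c i \<noteq> c j"
    proof
      assume eq: "c i = c j"
      then have lev: "?level i = ?level j"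
        using level[of i] level[of j] ij by (metis lessThan_iff)
      then have *: "i < e - a" "e - a < j" "a + i = 2 * e - a - j"
        using ij by (auto split: if_splits)
      then have "f (a + i) = g (a + i)"
        using eq unfolding c_def by auto
      moreover have "a < a + i"
        using * ij by auto
      moreover have "a + i < e"
        using * by auto
      ultimately show False
        using differ by blast
    qed
  qed
  moreover have "c (2 * (e - a)) = c 0"
  proof -
    have "2 * e - a - 2 * (e - a) = a"
      using a e by simp
    then show ?thesis
      using before[of a] c_on_g[of "2 * (e - a)"] a e unfolding c_def by simp
  qed
  moreover have "(c i, c (Suc i)) \<in> parcs T" if i: "i < 2 * (e - a)" for i
  proof (cases "i < e - a")
    case True
    then show ?thesis
      using geodesic_seg_arc[OF f, of "a + i"] e unfolding c_def by auto
  next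
    case False
    let ?l = "2 * e - a - Suc i"
    have "(g ?l, g (Suc ?l)) \<in> parcs T"
      using geodesic_seg_arc[OF g, of ?l] False i e by auto
    moreover have "Suc ?l = 2 * e - a - i"
      using i by auto
    ultimately show ?thesis
      using c_on_g[of i] c_on_g[of "Suc i"] False arcs_symmetric by auto
  qed
  moreover have "3 \<le> 2 * (e - a)"
    using e a by auto
  ultimately show False
    using no_circuit_sequence by blast
qed

lemma geodesic_rayD:
  assumes "geodesic_ray T x"
  shows "x n \<in> pverts T" and "hop_dist T (x m) (x n) = nat \<bar>int m - int n\<bar>"
proof -
  show V: "x n \<in> pverts T" for n
    using assms unfolding geodesic_ray_def by auto
  have "real (hop_dist T (x m) (x n)) = \<bar>real m - real n\<bar>"
    using assms graph_dist_eq_hop_dist[OF V V, of m n] unfolding geodesic_ray_def by simp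
  then show "hop_dist T (x m) (x n) = nat \<bar>int m - int n\<bar>"
    by linarith
qed

lemma geodesic_ray_seg:
  assumes "geodesic_ray T x"
  shows "geodesic_seg (\<lambda>i. x (a + i)) n"
  using geodesic_rayD[OF assms] unfolding geodesic_seg_def by auto

text \<open>
  Far out, two common points of the rays are passed in the same order and at the same time
  difference on both, so by uniqueness of geodesics the rays coincide between them. As there are
  common points arbitrarily far out, the rays coincide from any one of them on.
\<close>
lemma equivalent_rays_merge:
  assumes "(x, y) \<in> ray_equiv T"
  obtains a b where "\<And>t. x (a + t) = y (b + t)"
proof -
  have x: "geodesic_ray T x" and y: "geodesic_ray T y" and inf: "infinite (range x \<inter> range y)"
    using assms unfolding ray_equiv_def by auto
  define S where "S = {m. x m \<in> range y}"
  have "range x \<inter> range y \<subseteq> x ` S"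
    unfolding S_def by auto
  then have infS: "infinite S"
    using inf finite_surj by blast
  define b where "b m = (SOME n. x m = y n)" for m
  have b: "x m = y (b m)" if "m \<in> S" for m
    using that someI_ex[of "\<lambda>n. x m = y n"] unfolding b_def S_def by auto
  obtain a where a: "a \<in> S"
    using infS by (metis ex_in_conv finite.emptyI)
  have "x (a + t) = y (b a + t)" for t
  proof -
    obtain m where m: "m \<in> S" "a + b a + t < m"
      using infS infinite_nat_iff_unbounded by blast
    have "nat \<bar>int a - int m\<bar> = nat \<bar>int (b a) - int (b m)\<bar>"
      using geodesic_rayD(2)[OF x, of a m] geodesic_rayD(2)[OF y, of "b a" "b m"] b a m(1) by simp
    \<comment> \<open>As \<open>m - a\<close> exceeds \<open>b a\<close>, the ray \<open>y\<close> cannot run backwards from its meeting point with \<open>x\<close>.\<close>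
    then have bm: "b m = b a + (m - a)"
      using m(2) by linarith
    have "x (a + 0) = y (b a + 0)"
      using b a by simp
    moreover have "x (a + (m - a)) = y (b a + (m - a))"
      using b[OF m(1)] bm m(2) by simp
    ultimately show ?thesis
      using geodesic_seg_unique[OF geodesic_ray_seg[OF x, of a "m - a"]
          geodesic_ray_seg[OF y, of "b a" "m - a"], of t] m(2) by simp
  qed
  then show thesis by (rule that)
qed

lemma tree_endD:
  assumes "\<omega> \<in> tree_ends T" "x \<in> \<omega>"
  shows "geodesic_ray T x"
  using assms unfolding tree_ends_def ray_equiv_def by (auto simp: quotient_def)

text \<open>
  Both rays merge with a third ray of the end, hence with each other. From the common start to a common
  point far out they are geodesics with the same ends, so they agree there as well.
\<close>
lemma ray_determined_by_start:
  assumes "\<omega> \<in> tree_ends T" and "x \<in> \<omega>" "y \<in> \<omega>" and start: "x 0 = y 0"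
  shows "x = y"
proof -
  obtain z where z: "(z, x) \<in> ray_equiv T" "(z, y) \<in> ray_equiv T"
    using assms unfolding tree_ends_def by (auto simp: quotient_def)
  obtain a b where ab: "\<And>t. z (a + t) = x (b + t)"
    using equivalent_rays_merge z(1) by blast
  obtain c e where ce: "\<And>t. z (c + t) = y (e + t)"
    using equivalent_rays_merge z(2) by blast
  have x: "geodesic_ray T x" and y: "geodesic_ray T y"
    using tree_endD assms by blast+
  have merge: "x (b + c + t) = y (e + a + t)" for t
    using ab[of "c + t"] ce[of "a + t"] by (simp add: ac_simps)
  \<comment> \<open>The common starting vertex forces the two rays to merge at the same time.\<close>
  have "b + c = e + a"
    using geodesic_rayD(2)[OF x, of 0 "b + c"] geodesic_rayD(2)[OF y, of 0 "e + a"]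
      merge[of 0] start by simp
  then have "x (0 + t) = y (0 + t)" for t
    using geodesic_seg_unique[OF geodesic_ray_seg[OF x, of 0 "b + c + t"]
        geodesic_ray_seg[OF y, of 0 "b + c + t"], of t] merge[of t] start by simp
  then show "x = y" by auto
qed

end

lemma homogeneous_tree_imp_tree_graph:
  assumes "homogeneous_tree d T"
  shows "tree_graph T"
proof -
  have "pair_bidirected_digraph T" "connected (with_proj T)"
    "\<nexists>p. pre_digraph.cycle (with_proj T) p \<and> 3 \<le> length p"
    using assms unfolding homogeneous_tree_def undirected_tree_def by auto
  then show ?thesis
    by (simp add: tree_graph_def tree_graph_axioms_def connected_graph_def
        connected_graph_axioms_def not_le[symmetric])
qed

lemma homogeneous_tree_locally_finite:
  assumes "homogeneous_tree d T" "d > 0" "v \<in> pverts T"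
  shows "finite (out_arcs (with_proj T) v)"
proof -
  have "card (out_arcs (with_proj T) v) = d"
    using assms(1,3) unfolding homogeneous_tree_def out_degree_def by simp
  then show ?thesis
    using assms(2) by (intro card_ge_0_finite) simp
qed

section \<open>Compactness of sets of bounded displacement\<close>

lemma Aff_carrier_iff:
  "g \<in> carrier (Aff T \<omega>) \<longleftrightarrow> g \<in> tree_auts T \<and> (\<lambda>x. g \<circ> x) ` \<omega> = \<omega>"
  by (simp add: Aff_def)

lemma Aff_maps_vertices: "g \<in> carrier (Aff T \<omega>) \<Longrightarrow> v \<in> pverts T \<Longrightarrow> g v \<in> pverts T"
  by (rule Bij_apply) (simp_all add: Aff_carrier_iff tree_auts_def)

context tree_graph
begin

text \<open>
  Closedness of the stabiliser of an end among automorphisms of displacement at most \<open>r\<close>. Relations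
  between finitely many vertices pass to the limit at once. Surjectivity needs the bound \<open>r\<close>, without
  which the preimages of a vertex could escape to infinity. That the limit fixes the end needs the
  determination of rays by their start, as a ray is an infinite set of vertices.
\<close>
lemma Aff_pointwise_limit:
  assumes \<omega>: "\<omega> \<in> tree_ends T"
    and fin: "\<And>v. v \<in> pverts T \<Longrightarrow> finite (out_arcs (with_proj T) v)"
    and v0: "v0 \<in> pverts T" and g: "g \<in> extensional (pverts T)"
    and approx: "\<And>F. finite F \<Longrightarrow> F \<subseteq> pverts T \<Longrightarrow>
      \<exists>h\<in>carrier (Aff T \<omega>). hop_dist T v0 (h v0) \<le> r \<and> (\<forall>v\<in>F. h v = g v)"
  shows "g \<in> carrier (Aff T \<omega>)"
proof -
  let ?V = "pverts T"
  have AffD: "h \<in> Bij ?V" "h \<in> tree_auts T" "inj_on h ?V" "h ` ?V = ?V"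
      "(\<lambda>x. h \<circ> x) ` \<omega> = \<omega>"
    if "h \<in> carrier (Aff T \<omega>)" for h
    using that unfolding Aff_carrier_iff tree_auts_def Bij_def bij_betw_def by auto
  have Aff_end: "h \<circ> x \<in> \<omega>" if "h \<in> carrier (Aff T \<omega>)" "x \<in> \<omega>" for h x
    using imageI[OF that(2), of "\<lambda>x. h \<circ> x"] AffD(5)[OF that(1)] by simp
  have Aff_end_onto: "\<exists>x\<in>\<omega>. y = h \<circ> x" if "h \<in> carrier (Aff T \<omega>)" "y \<in> \<omega>" for h y
    using equalityD2[OF AffD(5)[OF that(1)], THEN subsetD, OF that(2)] by (auto simp: image_iff)
  have approx2: "\<exists>h\<in>carrier (Aff T \<omega>). h u = g u \<and> h v = g v" if "u \<in> ?V" "v \<in> ?V" for u v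
    using approx[of "{u, v}"] that by auto
  have maps: "g v \<in> ?V" if "v \<in> ?V" for v
    using approx2[OF that that] AffD(4) that by force
  have inj: "inj_on g ?V"
  proof (rule inj_onI)
    fix u v assume uv: "u \<in> ?V" "v \<in> ?V" "g u = g v"
    then obtain h where "h \<in> carrier (Aff T \<omega>)" "h u = h v"
      using approx2 by metis
    then show "u = v"
      using AffD(3) uv inj_onD by metis
  qed
  have surj: "w \<in> g ` ?V" if w: "w \<in> ?V" for w
  proof -
    \<comment> \<open>An automorphism of displacement at most \<open>r\<close> at \<open>v0\<close> has its preimage of \<open>w\<close> in this finite ball.\<close>
    let ?B = "{v \<in> ?V. hop_dist T v0 v \<le> r + hop_dist T v0 w}"
    have "finite ?B"
      using fin v0 by (rule finite_ball)
    then obtain h where h: "h \<in> carrier (Aff T \<omega>)" "hop_dist T v0 (h v0) \<le> r" "\<forall>v\<in>?B. h v = g v"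
      using approx[of ?B] by auto
    obtain v where v: "v \<in> ?V" "h v = w"
      using AffD(4)[OF h(1)] w by (metis imageE)
    have "hop_dist T v0 v = hop_dist T (h v0) w"
      using hop_dist_automorphism[OF AffD(2)[OF h(1)] v0 v(1)] v(2) by simp
    also have "\<dots> \<le> hop_dist T (h v0) v0 + hop_dist T v0 w"
      using hop_dist_triangle Bij_apply[OF AffD(1)[OF h(1)]] v0 w by blast
    also have "\<dots> \<le> r + hop_dist T v0 w"
      using h(2) hop_dist_sym by simp
    finally have "g v = w"
      using h(3) v by auto
    then show ?thesis using v(1) by blast
  qed
  have bij: "g \<in> Bij ?V"
    using g maps inj surj unfolding Bij_def bij_betw_def by auto
  have arcs: "(g u, g v) \<in> parcs T \<longleftrightarrow> (u, v) \<in> parcs T" if uv: "u \<in> ?V" "v \<in> ?V" for u v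
  proof -
    obtain h where h: "h \<in> carrier (Aff T \<omega>)" "h u = g u" "h v = g v"
      using approx2[OF uv] by blast
    have "(h u, h v) \<in> parcs T \<longleftrightarrow> (u, v) \<in> parcs T"
      using AffD(2)[OF h(1)] uv unfolding tree_auts_def by auto
    then show ?thesis
      using h(2,3) by simp
  qed
  \<comment> \<open>One element agreeing with \<open>g\<close> at the start of a ray already agrees with it along the whole ray.\<close>
  have on_ray: "h \<circ> x = g \<circ> x"
    if x: "x \<in> \<omega>" and h: "h \<in> carrier (Aff T \<omega>)" "h (x 0) = g (x 0)" for x h
  proof
    fix m
    have V: "x i \<in> ?V" for i
      using geodesic_rayD(1) tree_endD \<omega> x by blast
    obtain h' where h': "h' \<in> carrier (Aff T \<omega>)" "h' (x 0) = g (x 0)" "h' (x m) = g (x m)"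
      using approx2[OF V V] by blast
    have "h \<circ> x \<in> \<omega>" "h' \<circ> x \<in> \<omega>"
      using Aff_end h(1) h'(1) x by auto
    then have "h \<circ> x = h' \<circ> x"
      using ray_determined_by_start[OF \<omega>] h(2) h'(2) by simp
    then show "(h \<circ> x) m = (g \<circ> x) m"
      using h'(3) by (metis comp_apply)
  qed
  have "(\<lambda>x. g \<circ> x) ` \<omega> = \<omega>"
  proof
    show "(\<lambda>x. g \<circ> x) ` \<omega> \<subseteq> \<omega>"
    proof
      fix y assume "y \<in> (\<lambda>x. g \<circ> x) ` \<omega>"
      then obtain x where x: "x \<in> \<omega>" "y = g \<circ> x" by blast
      then have "x 0 \<in> ?V"
        using geodesic_rayD(1) tree_endD \<omega> by blast
      then obtain h where h: "h \<in> carrier (Aff T \<omega>)" "h (x 0) = g (x 0)"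
        using approx2 by blast
      then show "y \<in> \<omega>"
        using on_ray[OF x(1) h] Aff_end[OF h(1) x(1)] x(2) by simp
    qed
    show "\<omega> \<subseteq> (\<lambda>x. g \<circ> x) ` \<omega>"
    proof
      fix y assume y: "y \<in> \<omega>"
      then have "y 0 \<in> ?V"
        using geodesic_rayD(1) tree_endD \<omega> by blast
      then obtain v where v: "v \<in> ?V" "y 0 = g v"
        using surj by blast
      then obtain h where h: "h \<in> carrier (Aff T \<omega>)" "h v = g v"
        using approx2 by blast
      then obtain x where x: "x \<in> \<omega>" "y = h \<circ> x"
        using Aff_end_onto[OF h(1) y] by blast
      have "x 0 \<in> ?V"
        using x(1) geodesic_rayD(1) tree_endD \<omega> by blast
      then have "x 0 = v"
        using inj_onD[OF AffD(3)[OF h(1)], of "x 0" v] v h(2) x(2) by simp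
      then have "y = g \<circ> x"
        using on_ray[OF x(1) h(1)] h(2) x(2) by simp
      then show "y \<in> (\<lambda>x. g \<circ> x) ` \<omega>"
        using x(1) by blast
    qed
  qed
  then show ?thesis
    using bij arcs unfolding Aff_carrier_iff tree_auts_def by blast
qed

text \<open>
  The set is closed in the product of discrete spaces by \<open>Aff_pointwise_limit\<close>, and it lies in a product
  of finite balls, which is compact by Tychonoff's theorem.
\<close>
lemma compactin_Aff_bounded_displacement:
  assumes \<omega>: "\<omega> \<in> tree_ends T"
    and fin: "\<And>v. v \<in> pverts T \<Longrightarrow> finite (out_arcs (with_proj T) v)"
    and v0: "v0 \<in> pverts T"
  shows "compactin (Aff_topology T \<omega>) {g \<in> carrier (Aff T \<omega>). hop_dist T v0 (g v0) \<le> r}"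
    (is "compactin _ ?K")
proof -
  let ?V = "pverts T"
  let ?X = "product_topology (\<lambda>_. discrete_topology ?V) ?V"
  let ?B = "\<lambda>v. {w \<in> ?V. hop_dist T v0 w \<le> r + hop_dist T v0 v}"
  have auts: "g \<in> tree_auts T" "g \<in> Bij ?V" if "g \<in> ?K" for g
    using that unfolding Aff_carrier_iff tree_auts_def by auto
  have "compactin ?X (\<Pi>\<^sub>E v\<in>?V. ?B v)"
    using finite_ball[OF fin v0] by (auto simp: compactin_PiE compactin_discrete_topology)
  moreover have "?K \<subseteq> (\<Pi>\<^sub>E v\<in>?V. ?B v)"
  proof
    fix g assume g: "g \<in> ?K"
    have "hop_dist T v0 (g v) \<le> r + hop_dist T v0 v" if v: "v \<in> ?V" for v
    proof -
      have "hop_dist T v0 (g v) \<le> hop_dist T v0 (g v0) + hop_dist T (g v0) (g v)"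
        using hop_dist_triangle Bij_apply[OF auts(2)[OF g]] v0 v by blast
      then show ?thesis
        using hop_dist_automorphism[OF auts(1)[OF g] v0 v] g by simp
    qed
    then show "g \<in> (\<Pi>\<^sub>E v\<in>?V. ?B v)"
      using Bij_imp_extensional[OF auts(2)[OF g]] Bij_apply[OF auts(2)[OF g]]
      by (auto simp: PiE_iff)
  qed
  moreover have "closedin ?X ?K"
  proof -
    have "g \<in> ?K" if g: "g \<in> ?X closure_of ?K" for g
    proof -
      have gV: "g \<in> ?V \<rightarrow>\<^sub>E ?V"
        using g by (simp add: in_closure_of)
      have approx: "\<exists>h\<in>?K. \<forall>v\<in>F. h v = g v" if F: "finite F" "F \<subseteq> ?V" for F
      proof -
        let ?U = "\<Pi>\<^sub>E v\<in>?V. if v \<in> F then {g v} else ?V"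
        have "openin ?X ?U"
          by (rule openin_PiE_gen[THEN iffD2]) (use gV F in \<open>auto intro: finite_subset\<close>)
        moreover have "g \<in> ?U"
          using gV by auto
        ultimately obtain h where "h \<in> ?K" "h \<in> ?U"
          using g unfolding in_closure_of by blast
        then show ?thesis
          using F(2) by (intro bexI[of _ h]) (auto simp: PiE_iff split: if_splits)
      qed
      have "g \<in> carrier (Aff T \<omega>)"
      proof (rule Aff_pointwise_limit[OF \<omega> fin v0, where r = r])
        show "g \<in> extensional ?V"
          using gV by (auto simp: PiE_iff)
        show "\<exists>h\<in>carrier (Aff T \<omega>). hop_dist T v0 (h v0) \<le> r \<and> (\<forall>v\<in>F. h v = g v)"
          if "finite F" "F \<subseteq> ?V" for F
          using approx[OF that] by auto
      qed
      moreover have "hop_dist T v0 (g v0) \<le> r"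
        using approx[of "{v0}"] v0 by auto
      ultimately show "g \<in> ?K" by simp
    qed
    moreover have "?K \<subseteq> topspace ?X"
      using auts(2) Bij_imp_extensional Bij_apply by (fastforce simp: PiE_iff)
    ultimately show ?thesis
      using closure_of_subset_eq by blast
  qed
  ultimately have "compactin ?X ?K"
    by (rule closed_compactin)
  then show ?thesis
    unfolding Aff_topology_def by (simp add: compactin_subtopology subset_iff)
qed
end

section \<open>Lengths in the product group\<close>

lemma prod_length_eq_sum_hop_dist:
  assumes "\<And>i. i \<in> {1..k} \<Longrightarrow> connected_graph (T i)"
    and "\<And>i. i \<in> {1..k} \<Longrightarrow> base i \<in> pverts (T i)"
    and "\<alpha> \<in> carrier (Aff_prod k T \<omega>)"
  shows "prod_length k T base \<alpha> = real (\<Sum>i=1..k. hop_dist (T i) (base i) (\<alpha> i (base i)))"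
proof -
  have "graph_dist (T i) (base i) (\<alpha> i (base i)) = real (hop_dist (T i) (base i) (\<alpha> i (base i)))"
    if "i \<in> {1..k}" for i
  proof -
    have "\<alpha> i (base i) \<in> pverts (T i)"
      using assms(3) that by (intro Aff_maps_vertices[of "\<alpha> i" _ "\<omega> i"] assms(2)) (auto simp: Aff_prod_def)
    then show ?thesis
      by (rule connected_graph.graph_dist_eq_hop_dist[OF assms(1)[OF that] assms(2)[OF that]])
  qed
  then show ?thesis
    unfolding prod_length_def by simp
qed

lemma Aff_prod_mult_apply:
  assumes "\<beta> \<in> carrier (Aff_prod k T \<omega>)" "\<gamma> \<in> carrier (Aff_prod k T \<omega>)"
    and "i \<in> {1..k}" "v \<in> pverts (T i)"
  shows "(\<beta> \<otimes>\<^bsub>Aff_prod k T \<omega>\<^esub> \<gamma>) i v = \<beta> i (\<gamma> i v)"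
proof -
  have "\<beta> i \<in> Bij (pverts (T i))" "\<gamma> i \<in> Bij (pverts (T i))"
    using assms(1-3) by (auto simp: Aff_prod_def PiE_iff Aff_carrier_iff tree_auts_def)
  then show ?thesis
    using assms(3,4) by (simp add: Aff_prod_def Aff_def BijGroup_def compose_def)
qed

text \<open>
  Each summand depends on the vertex \<open>\<alpha> i (base i)\<close> only, which ranges over a discrete space.
\<close>
lemma continuous_map_prod_length:
  assumes "\<And>i. i \<in> {1..k} \<Longrightarrow> base i \<in> pverts (T i)"
  shows "continuous_map (Aff_prod_topology k T \<omega>) euclideanreal (prod_length k T base)"
proof -
  have "continuous_map (Aff_prod_topology k T \<omega>) euclideanreal
          (\<lambda>\<alpha>. graph_dist (T i) (base i) (\<alpha> i (base i)))" if i: "i \<in> {1..k}" for i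
  proof -
    have "continuous_map (Aff_prod_topology k T \<omega>) (Aff_topology (T i) (\<omega> i)) (\<lambda>\<alpha>. \<alpha> i)"
      unfolding Aff_prod_topology_def using i by (rule continuous_map_product_projection)
    moreover have "continuous_map (Aff_topology (T i) (\<omega> i)) (discrete_topology (pverts (T i)))
        (\<lambda>g. g (base i))"
      unfolding Aff_topology_def
      using assms[OF i] by (intro continuous_map_from_subtopology continuous_map_product_projection)
    moreover have "continuous_map (discrete_topology (pverts (T i))) euclideanreal
        (graph_dist (T i) (base i))"
      by simp
    ultimately have "continuous_map (Aff_prod_topology k T \<omega>) euclideanreal
        (graph_dist (T i) (base i) \<circ> ((\<lambda>g. g (base i)) \<circ> (\<lambda>\<alpha>. \<alpha> i)))"
      by (intro continuous_map_compose)
    then show ?thesis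
      by (simp add: comp_def)
  qed
  then have "continuous_map (Aff_prod_topology k T \<omega>) euclideanreal
      (\<lambda>\<alpha>. \<Sum>i=1..k. graph_dist (T i) (base i) (\<alpha> i (base i)))"
    by (intro continuous_map_sum) auto
  then show ?thesis
    unfolding prod_length_def by simp
qed

text \<open>
  A bound on the total length bounds the displacement in every coordinate, so the set is a closed subset
  of a product of compact sets.
\<close>
lemma compactin_Aff_prod_bounded_length:
  assumes trees: "\<And>i. i \<in> {1..k} \<Longrightarrow> tree_graph (T i)"
    and fin: "\<And>i v. i \<in> {1..k} \<Longrightarrow> v \<in> pverts (T i) \<Longrightarrow> finite (out_arcs (with_proj (T i)) v)"
    and base: "\<And>i. i \<in> {1..k} \<Longrightarrow> base i \<in> pverts (T i)"
    and ends: "\<And>i. i \<in> {1..k} \<Longrightarrow> \<omega> i \<in> tree_ends (T i)"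
  shows "compactin (Aff_prod_topology k T \<omega>)
    {\<alpha> \<in> carrier (Aff_prod k T \<omega>). prod_length k T base \<alpha> \<le> real r}"
    (is "compactin ?X ?C")
proof -
  let ?K = "\<lambda>i. {g \<in> carrier (Aff (T i) (\<omega> i)). hop_dist (T i) (base i) (g (base i)) \<le> r}"
  have graphs: "connected_graph (T i)" if "i \<in> {1..k}" for i
    using trees[OF that] by (simp add: tree_graph_def)
  have "compactin (Aff_topology (T i) (\<omega> i)) (?K i)" if "i \<in> {1..k}" for i
    using tree_graph.compactin_Aff_bounded_displacement[OF trees[OF that] ends[OF that] fin[OF that]
        base[OF that]] .
  then have "compactin ?X (\<Pi>\<^sub>E i\<in>{1..k}. ?K i)"
    unfolding Aff_prod_topology_def by (simp add: compactin_PiE)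
  moreover have "?C \<subseteq> (\<Pi>\<^sub>E i\<in>{1..k}. ?K i)"
  proof
    fix \<alpha> assume \<alpha>: "\<alpha> \<in> ?C"
    then have "prod_length k T base \<alpha> = real (\<Sum>i=1..k. hop_dist (T i) (base i) (\<alpha> i (base i)))"
      using graphs base by (intro prod_length_eq_sum_hop_dist) auto
    then have "real (\<Sum>i=1..k. hop_dist (T i) (base i) (\<alpha> i (base i))) \<le> real r"
      using \<alpha> by simp
    then have sum: "(\<Sum>i=1..k. hop_dist (T i) (base i) (\<alpha> i (base i))) \<le> r"
      by (simp only: of_nat_le_iff)
    have "hop_dist (T i) (base i) (\<alpha> i (base i)) \<le> r" if "i \<in> {1..k}" for i
      using member_le_sum[OF that, of "\<lambda>i. hop_dist (T i) (base i) (\<alpha> i (base i))"] sum by simp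
    then show "\<alpha> \<in> (\<Pi>\<^sub>E i\<in>{1..k}. ?K i)"
      using \<alpha> by (auto simp: Aff_prod_def PiE_iff)
  qed
  moreover have "closedin ?X ?C"
  proof -
    have "carrier (Aff (T i) (\<omega> i)) \<subseteq> pverts (T i) \<rightarrow>\<^sub>E pverts (T i)" for i
    proof
      fix g assume g: "g \<in> carrier (Aff (T i) (\<omega> i))"
      then have "g \<in> extensional (pverts (T i))"
        by (simp add: Aff_carrier_iff tree_auts_def Bij_imp_extensional)
      then show "g \<in> pverts (T i) \<rightarrow>\<^sub>E pverts (T i)"
        using Aff_maps_vertices[OF g] by (simp add: PiE_iff)
    qed
    then have "topspace ?X = carrier (Aff_prod k T \<omega>)"
      by (simp add: Aff_prod_topology_def Aff_topology_def Aff_prod_def Int_absorb1)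
    moreover have "continuous_map ?X euclideanreal (prod_length k T base)"
      using base by (rule continuous_map_prod_length)
    from closedin_continuous_map_preimage[OF this, where C = "{..real r}"]
    have "closedin ?X {\<alpha> \<in> topspace ?X. prod_length k T base \<alpha> \<le> real r}"
      by simp
    ultimately show ?thesis
      by simp
  qed
  ultimately show ?thesis
    by (rule closed_compactin)
qed

section \<open>Generation by elements of length at most one\<close>

text \<open>
  Induction on the length \<open>n + 1\<close> of \<open>\<alpha>\<close>: step back from \<open>\<alpha> o\<close> to an adjacent vertex \<open>y\<close> at distance \<open>n\<close>
  from \<open>o\<close>, and choose \<open>\<beta> \<in> \<Gamma>\<close> with \<open>\<beta> o = y\<close> by transitivity. Then \<open>\<beta>\<close> is generated by the
  induction hypothesis, and \<open>\<beta>\<inverse>\<alpha>\<close> moves \<open>o\<close> as far as \<open>\<alpha> o\<close> is from \<open>y\<close>, which is \<open>1\<close>.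
\<close>
lemma transitive_subgroup_generated_by_short_elements:
  assumes graphs: "\<And>i. i \<in> {1..k} \<Longrightarrow> connected_graph (T i)"
    and base: "\<And>i. i \<in> {1..k} \<Longrightarrow> base i \<in> pverts (T i)"
    and \<Gamma>: "subgroup \<Gamma> (Aff_prod k T \<omega>)"
    and trans: "transitive_action ((Aff_prod k T \<omega>)\<lparr>carrier := \<Gamma>\<rparr>) (tree_prod k T) (coord_action k T)"
  shows "generate (Aff_prod k T \<omega>) {\<alpha> \<in> \<Gamma>. prod_length k T base \<alpha> \<le> 1} = \<Gamma>"
    (is "generate ?P ?J = \<Gamma>")
proof
  show "generate ?P ?J \<subseteq> \<Gamma>"
  proof
    fix \<alpha> assume "\<alpha> \<in> generate ?P ?J"
    then show "\<alpha> \<in> \<Gamma>"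
      by (induction rule: generate.induct)
        (use \<Gamma> in \<open>auto intro: subgroup.one_closed subgroup.m_inv_closed subgroup.m_closed\<close>)
  qed
next
  let ?H = "?P\<lparr>carrier := \<Gamma>\<rparr>"
  let ?o = "restrict base {1..k}"
  let ?len = "\<lambda>\<alpha>. \<Sum>i=1..k. hop_dist (T i) (base i) (\<alpha> i (base i))"
  interpret transitive_action ?H "tree_prod k T" "coord_action k T"
    by (fact trans)
  interpret H: group ?H
    using group_hom group_hom.axioms(1) by blast
  have sub: "\<alpha> \<in> carrier ?P" if "\<alpha> \<in> \<Gamma>" for \<alpha>
    using subgroup.subset[OF \<Gamma>] that by blast
  have comp: "\<alpha> i \<in> carrier (Aff (T i) (\<omega> i))" if "\<alpha> \<in> \<Gamma>" "i \<in> {1..k}" for \<alpha> i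
    using sub[OF that(1)] that(2) by (auto simp: Aff_prod_def)
  have len: "prod_length k T base \<alpha> = real (?len \<alpha>)" if "\<alpha> \<in> \<Gamma>" for \<alpha>
    using graphs base sub[OF that] by (rule prod_length_eq_sum_hop_dist)
  have oV: "?o \<in> tree_prod k T"
    using base unfolding tree_prod_def by auto
  have "\<alpha> \<in> generate ?P ?J" if "\<alpha> \<in> \<Gamma>" "?len \<alpha> = n" for \<alpha> n
    using that
  proof (induction n arbitrary: \<alpha>)
    case 0
    then have "\<alpha> \<in> ?J"
      using len[of \<alpha>] by simp
    then show ?case by (rule generate.incl)
  next
    case (Suc n)
    have \<alpha>V: "\<alpha> j (base j) \<in> pverts (T j)" if "j \<in> {1..k}" for j
      using Aff_maps_vertices[OF comp[OF Suc.prems(1) that] base[OF that]] .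
    obtain i where i: "i \<in> {1..k}" "hop_dist (T i) (base i) (\<alpha> i (base i)) \<noteq> 0"
      using Suc.prems(2) by (metis (no_types, lifting) nat.distinct(1) sum.neutral)
    interpret Ti: connected_graph "T i"
      by (rule graphs[OF i(1)])
    obtain p where p: "hop_dist (T i) (base i) (\<alpha> i (base i)) = Suc p"
      using i(2) not0_implies_Suc by blast
    obtain w where w: "w \<in> pverts (T i)" "hop_dist (T i) (base i) w = p"
        "(w, \<alpha> i (base i)) \<in> parcs (T i)"
      using Ti.hop_dist_Suc_predecessor[OF base[OF i(1)] \<alpha>V[OF i(1)] p] by blast
    define y where "y = (\<lambda>j\<in>{1..k}. if j = i then w else \<alpha> j (base j))"
    have "y \<in> tree_prod k T"
      using w(1) \<alpha>V unfolding y_def tree_prod_def by auto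
    then obtain \<beta> where \<beta>: "\<beta> \<in> \<Gamma>" "coord_action k T \<beta> ?o = y"
      using unique_orbit[OF oV] by auto
    have \<beta>o: "\<beta> j (base j) = y j" if "j \<in> {1..k}" for j
      using fun_cong[OF \<beta>(2), of j] oV that unfolding coord_action_def by simp
    have "?len \<beta> = n"
    proof -
      let ?S = "\<Sum>j\<in>{1..k} - {i}. hop_dist (T j) (base j) (\<alpha> j (base j))"
      have "?len \<beta> = p + (\<Sum>j\<in>{1..k} - {i}. hop_dist (T j) (base j) (\<beta> j (base j)))"
        using sum.remove[OF finite_atLeastAtMost i(1), of "\<lambda>j. hop_dist (T j) (base j) (\<beta> j (base j))"]
          \<beta>o[OF i(1)] w(2) i(1) unfolding y_def by simp
      also have "\<dots> = p + ?S"
        using \<beta>o by (intro arg_cong2[of _ _ _ _ "(+)"] sum.cong) (auto simp: y_def)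
      finally have "?len \<beta> = p + ?S" .
      moreover have "?len \<alpha> = Suc p + ?S"
        using sum.remove[OF finite_atLeastAtMost i(1), of "\<lambda>j. hop_dist (T j) (base j) (\<alpha> j (base j))"] p
        by simp
      ultimately show ?thesis using Suc.prems(2) by simp
    qed
    then have gen\<beta>: "\<beta> \<in> generate ?P ?J"
      using Suc.IH \<beta>(1) by blast
    \<comment> \<open>The inverse is taken in \<open>\<Gamma>\<close>, which is a group because it acts.\<close>
    define \<gamma> where "\<gamma> = inv\<^bsub>?H\<^esub> \<beta> \<otimes>\<^bsub>?P\<^esub> \<alpha>"
    have \<gamma>: "\<gamma> \<in> \<Gamma>"
      using H.m_closed[OF H.inv_closed, of \<beta> \<alpha>] \<beta>(1) Suc.prems(1) unfolding \<gamma>_def by simp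
    have \<alpha>_eq: "\<alpha> = \<beta> \<otimes>\<^bsub>?P\<^esub> \<gamma>"
      using H.inv_solve_left[of \<gamma> \<beta> \<alpha>] \<beta>(1) \<gamma> Suc.prems(1) unfolding \<gamma>_def by simp
    have "hop_dist (T j) (base j) (\<gamma> j (base j)) = (if j = i then 1 else 0)" if j: "j \<in> {1..k}" for j
    proof -
      interpret Tj: connected_graph "T j"
        by (rule graphs[OF j])
      have \<gamma>V: "\<gamma> j (base j) \<in> pverts (T j)"
        using Aff_maps_vertices[OF comp[OF \<gamma> j] base[OF j]] .
      have "hop_dist (T j) (base j) (\<gamma> j (base j))
          = hop_dist (T j) (\<beta> j (base j)) (\<beta> j (\<gamma> j (base j)))"
        using Tj.hop_dist_automorphism[OF _ base[OF j] \<gamma>V, of "\<beta> j"] comp[OF \<beta>(1) j]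
        by (simp add: Aff_carrier_iff)
      also have "\<dots> = hop_dist (T j) (y j) (\<alpha> j (base j))"
        using Aff_prod_mult_apply[OF sub[OF \<beta>(1)] sub[OF \<gamma>] j base[OF j]] \<alpha>_eq \<beta>o[OF j] by simp
      also have "\<dots> = (if j = i then 1 else 0)"
        using Ti.hop_dist_eq_1_iff[OF w(1) \<alpha>V[OF i(1)]] w(3) j unfolding y_def by simp
      finally show ?thesis .
    qed
    then have "?len \<gamma> = 1"
      using i(1) by (simp add: sum.delta)
    then have "\<gamma> \<in> generate ?P ?J"
      using \<gamma> len[OF \<gamma>] by (intro generate.incl) simp
    then show ?case
      using gen\<beta> \<alpha>_eq generate.eng by metis
  qed
  then show "\<Gamma> \<subseteq> generate ?P ?J" by blast
qed

theorem proposition3p2p7: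
  fixes k :: nat
    and d :: "nat \<Rightarrow> nat"
    and T :: "nat \<Rightarrow> 'v pair_pre_digraph"
    and base :: "nat \<Rightarrow> 'v"
    and \<omega> :: "nat \<Rightarrow> (nat \<Rightarrow> 'v) set"
    and \<Gamma> J :: "(nat \<Rightarrow> 'v \<Rightarrow> 'v) set"
  assumes "\<And>i. i \<in> {1..k} \<Longrightarrow> d i \<ge> 3"
    and "\<And>i. i \<in> {1..k} \<Longrightarrow> homogeneous_tree (d i) (T i)"
    and "\<And>i. i \<in> {1..k} \<Longrightarrow> base i \<in> pverts (T i)"
    and "\<And>i. i \<in> {1..k} \<Longrightarrow> \<omega> i \<in> tree_ends (T i)"
    and "subgroup \<Gamma> (Aff_prod k T \<omega>)"
    and "closedin (Aff_prod_topology k T \<omega>) \<Gamma>"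
    and "transitive_action ((Aff_prod k T \<omega>)\<lparr>carrier := \<Gamma>\<rparr>) (tree_prod k T) (coord_action k T)"
  defines "J \<equiv> {\<alpha> \<in> \<Gamma>. prod_length k T base \<alpha> \<le> 1}"
  shows "compactin (subtopology (Aff_prod_topology k T \<omega>) \<Gamma>) J
    \<and> (\<exists>U. openin (subtopology (Aff_prod_topology k T \<omega>) \<Gamma>) U
           \<and> \<one>\<^bsub>Aff_prod k T \<omega>\<^esub> \<in> U \<and> U \<subseteq> J)
    \<and> generate (Aff_prod k T \<omega>) J = \<Gamma>"
proof (intro conjI)
  let ?P = "Aff_prod k T \<omega>" and ?X = "Aff_prod_topology k T \<omega>"
  have trees: "tree_graph (T i)" if "i \<in> {1..k}" for i
    using homogeneous_tree_imp_tree_graph[OF assms(2)[OF that]] .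
  have graphs: "connected_graph (T i)" if "i \<in> {1..k}" for i
    using trees[OF that] by (simp add: tree_graph_def)
  have fin: "finite (out_arcs (with_proj (T i)) v)" if "i \<in> {1..k}" "v \<in> pverts (T i)" for i v
    using homogeneous_tree_locally_finite[OF assms(2)[OF that(1)] _ that(2)] assms(1)[OF that(1)] by simp
  have sub: "\<Gamma> \<subseteq> carrier ?P"
    using assms(5) by (rule subgroup.subset)

  have "compactin ?X {\<alpha> \<in> carrier ?P. prod_length k T base \<alpha> \<le> real 1}"
    using trees fin assms(3,4) by (rule compactin_Aff_prod_bounded_length)
  then have "compactin ?X (\<Gamma> \<inter> {\<alpha> \<in> carrier ?P. prod_length k T base \<alpha> \<le> real 1})"
    by (rule closed_Int_compactin[OF assms(6)])
  moreover have "\<Gamma> \<inter> {\<alpha> \<in> carrier ?P. prod_length k T base \<alpha> \<le> real 1} = J"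
    using sub unfolding J_def by auto
  ultimately show "compactin (subtopology ?X \<Gamma>) J"
    unfolding J_def by (simp add: compactin_subtopology)

  show "\<exists>U. openin (subtopology ?X \<Gamma>) U \<and> \<one>\<^bsub>?P\<^esub> \<in> U \<and> U \<subseteq> J"
  proof (intro exI conjI)
    let ?U = "{\<alpha> \<in> \<Gamma>. prod_length k T base \<alpha> < 1}"
    have "continuous_map (subtopology ?X \<Gamma>) euclideanreal (prod_length k T base)"
      using assms(3) by (intro continuous_map_from_subtopology continuous_map_prod_length)
    from openin_continuous_map_preimage[OF this, where U = "{..<1}"]
    show "openin (subtopology ?X \<Gamma>) ?U"
      using closedin_subset[OF assms(6)] by (simp add: Int_absorb1)
    have "\<one>\<^bsub>?P\<^esub> i (base i) = base i" if "i \<in> {1..k}" for i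
      using assms(3)[OF that] that by (simp add: Aff_prod_def Aff_def BijGroup_def)
    then have "graph_dist (T i) (base i) (\<one>\<^bsub>?P\<^esub> i (base i)) = 0" if "i \<in> {1..k}" for i
      using that graphs[OF that] assms(3)[OF that]
      by (simp add: connected_graph.graph_dist_eq_hop_dist connected_graph.hop_dist_refl)
    then have "prod_length k T base \<one>\<^bsub>?P\<^esub> = 0"
      unfolding prod_length_def by simp
    then show "\<one>\<^bsub>?P\<^esub> \<in> ?U"
      using subgroup.one_closed[OF assms(5)] by simp
    show "?U \<subseteq> J"
      unfolding J_def by auto
  qed

  show "generate ?P J = \<Gamma>"
    unfolding J_def using graphs assms(3,5,7) by (rule transitive_subgroup_generated_by_short_elements)
qed

end
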